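(* The tropical Griffiths conjecture of Cao and Zheng is not true when $d>1$: for every integer $d>1$ there exist positive integers $n,q$ with $q>M$, where $M=\binom{n+d}{d}-1$, a tropical algebraically nondegenerate tropical holomorphic curve $f:\mathbb{R}\to\mathbb{TP}^n$ with $$\limsup_{r\to\infty}\frac{\log T_f(r)}{r}=0,$$ and homogeneous tropical polynomials $P_0,\dots,P_q$ of degrees $d_0,\dots,d_q$ with least common multiple $d$, such that, with $\lambda=\operatorname{ddg}(\{P_{M+1}\circ f,\dots,P_q\circ f\})$, the inequality $$\sum_{j=0}^q\delta(V_{P_j},f)\le\frac{n+1+\lambda}{d}$$ fails.
   Context: $0_\circ=-\infty$, $1_\circ=0$, $a\oslash b=a-b$, so $1_\circ\oslash g=-g$; $g^{\otimes s}=sg$. A tropical entire function is a convex (continuous) piecewise linear $g:\mathbb{R}\to\mathbb{R}$ with finitely many affine pieces on each bounded interval; a root of $g$ is a point $x$ where $\omega_g(x)=\lim_{\varepsilon\to0^+}(g'(x+\varepsilon)-g'(x-\varepsilon))>0$, of multiplicity $\omega_g(x)$. Then $N(r,1_\circ\oslash g)=\frac12\sum_{|c|<r}\omega_g(c)(r-|c|)$ over the roots $c$ of $g$ in $(-r,r)$. $\mathbb{TP}^n$ is the quotient of $(\mathbb{R}\cup\{-\infty\})^{n+1}\setminus\{(-\infty,\dots,-\infty)\}$ by adding a common real constant to all coordinates. A tropical holomorphic curve is $f=[f_0:\cdots:f_n]$ with $f_i$ tropical entire having no root common to all of them; $T_f(r)=\frac12(\|f(r)\|+\|f(-r)\|)$,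 $\|f(x)\|=\max_i f_i(x)$. A homogeneous tropical polynomial of degree $e$ here is $P(x_0,\dots,x_n)=\max_I\{c_I+i_0x_0+\cdots+i_nx_n\}$ over $I=(i_0,\dots,i_n)\in\mathbb{Z}_{\ge0}^{n+1}$ with $\sum i_k=e$, $c_I\in\mathbb{R}\cup\{-\infty\}$ not all $-\infty$. $V_P\subset\mathbb{TP}^n$ is its tropical hypersurface, the set of roots of $P$ (points where the maximum is attained by at least two terms). $f$ is tropical algebraically nondegenerate if $f(\mathbb{R})\not\subset V_P$ for every such $P$ (of any degree). The defect of $P$ of degree $e$ is $\delta(V_P,f)=1-\limsup_{r\to\infty}\frac{N(r,1_\circ\oslash(P\circ f))}{e\,T_f(r)}$. Let $I_0,\dots,I_M$ be the exponents of degree $d$ and $f^{I}=i_0f_0+\cdots+i_nf_n$. For $F=\max_k\{a_k+f^{I_k}\}$ with $a_k\in\mathbb{R}\cup\{-\infty\}$, let $\hat\ell(F)$ be the least number of terms with real coefficients needed to write $F$ in such a form; $F$ is complete if $\hat\ell(F)=M+1$. The degree of degeneracy $\operatorname{ddg}(\{P_{M+1}\circ f,\dots,P_q\circ f\})$ is the number of indices $j\in\{M+1,\dots,q\}$ for which $P_j^{\otimes d/d_j}\circ f$ is not complete. *)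

theory Defs
  imports "HOL-Analysis.Analysis"
begin

text \<open>Tropical numbers (the reals with \<open>-\<infinity>\<close>) are represented by extended reals different
  from \<open>\<infinity>\<close>; the tropical sum is \<open>max\<close>, the tropical product is \<open>+\<close>.\<close>

subsection \<open>Tropical entire functions\<close>

definition tropical_entire :: "(real \<Rightarrow> real) \<Rightarrow> bool" where
  "tropical_entire g \<longleftrightarrow>
     convex_on UNIV g \<and> continuous_on UNIV g \<and>
     (\<forall>a b. \<exists>S. finite S \<and>
        (\<forall>u v. {u<..<v} \<subseteq> {a..b} - S \<longrightarrow>
           (\<exists>m k. \<forall>x\<in>{u<..<v}. g x = m * x + k)))"

definition trop_omega :: "(real \<Rightarrow> real) \<Rightarrow> real \<Rightarrow> real" where
  "trop_omega g x = Lim (at_right 0) (\<lambda>\<epsilon>. deriv g (x + \<epsilon>) - deriv g (x - \<epsilon>))"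

definition trop_root :: "(real \<Rightarrow> real) \<Rightarrow> real \<Rightarrow> bool" where
  "trop_root g x \<longleftrightarrow> trop_omega g x > 0"

definition trop_power :: "nat \<Rightarrow> (real \<Rightarrow> real) \<Rightarrow> real \<Rightarrow> real" where
  "trop_power s g = (\<lambda>x. real s * g x)"

text \<open>\<open>N_recip g r\<close> is \<open>N(r, 1 \<oslash> g)\<close>: the poles of \<open>1 \<oslash> g = -g\<close> are the roots of \<open>g\<close>.
  It is meant for tropical entire \<open>g\<close>, where the sum is finite.\<close>

definition N_recip :: "(real \<Rightarrow> real) \<Rightarrow> real \<Rightarrow> real" where
  "N_recip g r = 1 / 2 * (\<Sum>c\<in>{c. trop_root g c \<and> \<bar>c\<bar> < r}. trop_omega g c * (r - \<bar>c\<bar>))"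

subsection \<open>Tropical projective space and holomorphic curves\<close>

definition tcoords :: "nat \<Rightarrow> (nat \<Rightarrow> ereal) set" where
  "tcoords n = ({..n} \<rightarrow>\<^sub>E {x. x \<noteq> \<infinity>}) - {\<lambda>i\<in>{..n}. -\<infinity>}"

definition tproj_rel :: "nat \<Rightarrow> ((nat \<Rightarrow> ereal) \<times> (nat \<Rightarrow> ereal)) set" where
  "tproj_rel n = {(x, y). x \<in> tcoords n \<and> y \<in> tcoords n \<and>
                          (\<exists>a::real. \<forall>i\<le>n. y i = ereal a + x i)}"

definition tproj :: "nat \<Rightarrow> (nat \<Rightarrow> ereal) set set" where
  "tproj n = tcoords n // tproj_rel n"

text \<open>A curve is given by the tuple \<open>f 0, \<dots>, f n\<close> (components with index above \<open>n\<close> are ignored);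
  \<open>curve_point n f\<close> is the induced map \<open>[f 0 : \<dots> : f n]\<close> from the reals to projective space.\<close>

definition curve_point :: "nat \<Rightarrow> (nat \<Rightarrow> real \<Rightarrow> real) \<Rightarrow> real \<Rightarrow> (nat \<Rightarrow> ereal) set" where
  "curve_point n f t = tproj_rel n `` {\<lambda>i\<in>{..n}. ereal (f i t)}"

definition tropical_holomorphic_curve :: "nat \<Rightarrow> (nat \<Rightarrow> real \<Rightarrow> real) \<Rightarrow> bool" where
  "tropical_holomorphic_curve n f \<longleftrightarrow>
     (\<forall>i\<le>n. tropical_entire (f i)) \<and> \<not> (\<exists>x. \<forall>i\<le>n. trop_root (f i) x)"

definition curve_norm :: "nat \<Rightarrow> (nat \<Rightarrow> real \<Rightarrow> real) \<Rightarrow> real \<Rightarrow> real" where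
  "curve_norm n f x = Max ((\<lambda>i. f i x) ` {..n})"

definition trop_T :: "nat \<Rightarrow> (nat \<Rightarrow> real \<Rightarrow> real) \<Rightarrow> real \<Rightarrow> real" where
  "trop_T n f r = 1 / 2 * (curve_norm n f r + curve_norm n f (- r))"

subsection \<open>Homogeneous tropical polynomials\<close>

definition exponents :: "nat \<Rightarrow> nat \<Rightarrow> (nat \<Rightarrow> nat) set" where
  "exponents n e = {I. (\<forall>k>n. I k = 0) \<and> (\<Sum>k\<le>n. I k) = e}"

text \<open>A homogeneous polynomial of degree \<open>e\<close> in \<open>n + 1\<close> variables is given by its coefficients
  on \<open>exponents n e\<close>; values of \<open>c\<close> elsewhere are ignored.\<close>

definition hom_tpoly :: "nat \<Rightarrow> nat \<Rightarrow> ((nat \<Rightarrow> nat) \<Rightarrow> ereal) \<Rightarrow> bool" where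
  "hom_tpoly n e c \<longleftrightarrow>
     (\<forall>I\<in>exponents n e. c I \<noteq> \<infinity>) \<and> (\<exists>I\<in>exponents n e. c I \<noteq> -\<infinity>)"

text \<open>Note \<open>0 * (-\<infinity>) = 0\<close> in \<open>ereal\<close>: a variable with exponent \<open>0\<close> does not contribute.\<close>

definition tterm :: "nat \<Rightarrow> ((nat \<Rightarrow> nat) \<Rightarrow> ereal) \<Rightarrow> (nat \<Rightarrow> ereal) \<Rightarrow> (nat \<Rightarrow> nat) \<Rightarrow> ereal" where
  "tterm n c x I = c I + (\<Sum>k\<le>n. ereal (real (I k)) * x k)"

definition tpoly_eval :: "nat \<Rightarrow> nat \<Rightarrow> ((nat \<Rightarrow> nat) \<Rightarrow> ereal) \<Rightarrow> (nat \<Rightarrow> ereal) \<Rightarrow> ereal" where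
  "tpoly_eval n e c x = Max (tterm n c x ` exponents n e)"

definition tpoly_root :: "nat \<Rightarrow> nat \<Rightarrow> ((nat \<Rightarrow> nat) \<Rightarrow> ereal) \<Rightarrow> (nat \<Rightarrow> ereal) \<Rightarrow> bool" where
  "tpoly_root n e c x \<longleftrightarrow>
     (\<exists>I\<in>exponents n e. \<exists>J\<in>exponents n e. I \<noteq> J \<and>
        tterm n c x I = tpoly_eval n e c x \<and> tterm n c x J = tpoly_eval n e c x)"

definition trop_hypersurface ::
    "nat \<Rightarrow> nat \<Rightarrow> ((nat \<Rightarrow> nat) \<Rightarrow> ereal) \<Rightarrow> (nat \<Rightarrow> ereal) set set" where
  "trop_hypersurface n e c = {p \<in> tproj n. \<exists>x\<in>p. tpoly_root n e c x}"

definition trop_alg_nondegenerate :: "nat \<Rightarrow> (nat \<Rightarrow> real \<Rightarrow> real) \<Rightarrow> bool" where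
  "trop_alg_nondegenerate n f \<longleftrightarrow>
     (\<forall>e c. hom_tpoly n e c \<longrightarrow> \<not> range (curve_point n f) \<subseteq> trop_hypersurface n e c)"

definition tpoly_comp ::
    "nat \<Rightarrow> nat \<Rightarrow> ((nat \<Rightarrow> nat) \<Rightarrow> ereal) \<Rightarrow> (nat \<Rightarrow> real \<Rightarrow> real) \<Rightarrow> real \<Rightarrow> real" where
  "tpoly_comp n e c f t = real_of_ereal (tpoly_eval n e c (\<lambda>k. ereal (f k t)))"

definition trop_defect ::
    "nat \<Rightarrow> nat \<Rightarrow> ((nat \<Rightarrow> nat) \<Rightarrow> ereal) \<Rightarrow> (nat \<Rightarrow> real \<Rightarrow> real) \<Rightarrow> ereal" where
  "trop_defect n e c f =
     1 - Limsup at_top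
           (\<lambda>r. ereal (N_recip (tpoly_comp n e c f) r / (real e * trop_T n f r)))"

subsection \<open>Completeness and degree of degeneracy\<close>

definition represents ::
    "nat \<Rightarrow> nat \<Rightarrow> (nat \<Rightarrow> real \<Rightarrow> real) \<Rightarrow> ((nat \<Rightarrow> nat) \<Rightarrow> ereal) \<Rightarrow> (real \<Rightarrow> real) \<Rightarrow> bool" where
  "represents n d f a F \<longleftrightarrow>
     (\<forall>I\<in>exponents n d. a I \<noteq> \<infinity>) \<and>
     (\<forall>t. ereal (F t) = tpoly_eval n d a (\<lambda>k. ereal (f k t)))"

text \<open>For \<open>F\<close> without any representation this is \<open>Inf {} = 0\<close>, so such \<open>F\<close> is not complete.\<close>

definition ell_hat :: "nat \<Rightarrow> nat \<Rightarrow> (nat \<Rightarrow> real \<Rightarrow> real) \<Rightarrow> (real \<Rightarrow> real) \<Rightarrow> nat" where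
  "ell_hat n d f F = Inf {card {I \<in> exponents n d. a I \<noteq> -\<infinity>} | a. represents n d f a F}"

definition trop_complete :: "nat \<Rightarrow> nat \<Rightarrow> (nat \<Rightarrow> real \<Rightarrow> real) \<Rightarrow> (real \<Rightarrow> real) \<Rightarrow> bool" where
  "trop_complete n d f F \<longleftrightarrow> ell_hat n d f F = ((n + d) choose d)"

definition ddg ::
    "nat \<Rightarrow> nat \<Rightarrow> nat set \<Rightarrow> (nat \<Rightarrow> nat) \<Rightarrow> (nat \<Rightarrow> (nat \<Rightarrow> nat) \<Rightarrow> ereal) \<Rightarrow>
       (nat \<Rightarrow> real \<Rightarrow> real) \<Rightarrow> nat" where
  "ddg n d J dg P f =
     card {j\<in>J. \<not> trop_complete n d f (trop_power (d div dg j) (tpoly_comp n (dg j) (P j) f))}"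

end

theory Submission
  imports Defs "HOL-Real_Asymp.Real_Asymp"
begin

text \<open>Take \<open>n = 1\<close> and the curve \<open>f(t) = [0 : t]\<close>. It meets every finite point of the projective
  line, while a hypersurface contains only finitely many of these, so \<open>f\<close> is algebraically
  nondegenerate. The components of \<open>f\<close> have no roots, so the composition of any monomial with \<open>f\<close>
  is affine and the monomial has defect \<open>1\<close>. With \<open>q = M + 1 = d + 1\<close> and monomials of degree \<open>d\<close>,
  the defects add up to \<open>d + 2\<close>, whereas \<open>\<lambda> \<le> 1\<close> bounds the right-hand side by \<open>3 / d\<close>.\<close>

lemma trop_omega_affine: "trop_omega (\<lambda>x. m * x + k) x = 0"
proof -
  have "deriv (\<lambda>x. m * x + k) y = m" for y :: real
    by (rule DERIV_imp_deriv) (auto intro!: derivative_eq_intros)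
  then show ?thesis
    by (simp add: trop_omega_def tendsto_Lim)
qed

lemma N_recip_affine: "N_recip (\<lambda>x. m * x + k) r = 0"
  by (simp add: N_recip_def trop_omega_affine)

text \<open>An affine function has no roots, so the counting function in the numerator is
  identically \<open>0\<close>. The quotient is then \<open>0\<close> whatever the denominator, even
  where that vanishes.\<close>

lemma trop_defect_eq_1_if_affine:
  assumes "\<And>t. tpoly_comp n e c f t = m * t + k"
  shows "trop_defect n e c f = 1"
proof -
  have "tpoly_comp n e c f = (\<lambda>t. m * t + k)"
    using assms by (rule ext)
  then show ?thesis
    by (simp add: trop_defect_def N_recip_affine Limsup_const flip: zero_ereal_def)
qed

lemma tropical_entire_affine: "tropical_entire (\<lambda>x. m * x + k)"
  unfolding tropical_entire_def
proof (intro conjI allI)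
  show "convex_on UNIV (\<lambda>x. m * x + k)"
    by (rule convex_onI) (auto simp: algebra_simps)
  show "continuous_on UNIV (\<lambda>x. m * x + k)"
    by (intro continuous_intros)
  show "\<exists>S. finite S \<and> (\<forall>u v. {u<..<v} \<subseteq> {a..b} - S \<longrightarrow>
          (\<exists>m' k'. \<forall>x\<in>{u<..<v}. m * x + k = m' * x + k'))" for a b :: real
    by (intro exI[of _ "{}"]) auto
qed

text \<open>Each entry is bounded by the total degree. Finiteness is what gives the
  \<open>Max\<close> in \<open>tpoly_eval\<close> its usual properties.\<close>

lemma finite_exponents: "finite (exponents n e)"
proof (rule finite_subset)
  show "exponents n e \<subseteq> {I. \<forall>k. (k \<in> {..n} \<longrightarrow> I k \<in> {..e}) \<and> (k \<notin> {..n} \<longrightarrow> I k = 0)}"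
  proof (clarsimp simp: exponents_def)
    fix I :: "nat \<Rightarrow> nat" and k
    assume "k \<le> n"
    then show "I k \<le> (\<Sum>k\<le>n. I k)"
      by (intro member_le_sum) auto
  qed
  show "finite {I. \<forall>k. (k \<in> {..n} \<longrightarrow> I k \<in> {..e}) \<and> (k \<notin> {..n} \<longrightarrow> I k = (0::nat))}"
    by (rule finite_set_of_finite_funs) auto
qed

lemma tterm_real:
  "tterm n c (\<lambda>k. ereal (x k)) I = c I + ereal (\<Sum>k\<le>n. real (I k) * x k)"
  by (simp add: tterm_def)

definition tmonomial :: "(nat \<Rightarrow> nat) \<Rightarrow> real \<Rightarrow> (nat \<Rightarrow> nat) \<Rightarrow> ereal" where
  "tmonomial I a = (\<lambda>J. if J = I then ereal a else -\<infinity>)"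

lemma hom_tpoly_tmonomial:
  assumes "I \<in> exponents n e"
  shows "hom_tpoly n e (tmonomial I a)"
  using assms by (auto simp: hom_tpoly_def tmonomial_def)

lemma tpoly_comp_tmonomial:
  assumes "I \<in> exponents n e"
  shows "tpoly_comp n e (tmonomial I a) f t = a + (\<Sum>k\<le>n. real (I k) * f k t)"
proof -
  have "tpoly_eval n e (tmonomial I a) (\<lambda>k. ereal (f k t)) =
          ereal (a + (\<Sum>k\<le>n. real (I k) * f k t))"
    unfolding tpoly_eval_def
  proof (rule Max_eqI)
    show "finite (tterm n (tmonomial I a) (\<lambda>k. ereal (f k t)) ` exponents n e)"
      by (simp add: finite_exponents)
    show "y \<le> ereal (a + (\<Sum>k\<le>n. real (I k) * f k t))"
      if "y \<in> tterm n (tmonomial I a) (\<lambda>k. ereal (f k t)) ` exponents n e" for y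
      using that by (auto simp: tterm_real tmonomial_def)
    show "ereal (a + (\<Sum>k\<le>n. real (I k) * f k t)) \<in>
            tterm n (tmonomial I a) (\<lambda>k. ereal (f k t)) ` exponents n e"
      using assms by (intro image_eqI[of _ _ I]) (simp_all add: tterm_real tmonomial_def)
  qed
  then show ?thesis
    by (simp add: tpoly_comp_def)
qed

definition line :: "nat \<Rightarrow> real \<Rightarrow> real" where
  "line k t = real k * t"

lemma tropical_holomorphic_curve_line: "tropical_holomorphic_curve n line"
proof -
  have "line k = (\<lambda>t. real k * t + 0)" for k
    by (simp add: line_def fun_eq_iff)
  then show ?thesis
    by (simp only: tropical_holomorphic_curve_def trop_root_def trop_omega_affine
        tropical_entire_affine) auto
qed

text \<open>The norm of \<open>[0 : t]\<close> is \<open>max 0 t\<close>, so only the endpoint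
  \<open>r\<close> contributes.\<close>

lemma trop_T_line: "r \<ge> 0 \<Longrightarrow> trop_T 1 line r = r / 2"
  by (simp add: trop_T_def curve_norm_def line_def atMost_Suc)

lemma Limsup_ln_trop_T_line:
  "Limsup at_top (\<lambda>r. ereal (ln (trop_T 1 line r) / r)) = 0"
proof (rule lim_imp_Limsup)
  have "((\<lambda>r::real. ln (r / 2) / r) \<longlongrightarrow> 0) at_top"
    by real_asymp
  moreover have "\<forall>\<^sub>F r in at_top. ln (r / 2) / r = ln (trop_T 1 line r) / r"
    using eventually_ge_at_top[of 0] by eventually_elim (simp only: trop_T_line)
  ultimately have "((\<lambda>r. ln (trop_T 1 line r) / r) \<longlongrightarrow> 0) at_top"
    by (rule Lim_transform_eventually)
  then show "((\<lambda>r. ereal (ln (trop_T 1 line r) / r)) \<longlongrightarrow> 0) at_top"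
    by (simp add: zero_ereal_def)
qed simp

lemma exponents_1_iff:
  "I \<in> exponents 1 e \<longleftrightarrow> (\<forall>k>1. I k = 0) \<and> I 0 + I 1 = e"
  by (auto simp: exponents_def)

lemma exponents_1_eqI:
  assumes "I \<in> exponents 1 e" "J \<in> exponents 1 e" "I 1 = J 1"
  shows "I = J"
proof
  fix k :: nat
  consider "k = 0" | "k = 1" | "k > 1" by linarith
  then show "I k = J k"
    using assms unfolding exponents_1_iff by cases auto
qed

text \<open>Equating two maximal terms and eliminating the exponents of \<open>x 0\<close> by
  homogeneity leaves a linear equation for \<open>x 1 - x 0\<close>. Its solutions over all pairs
  \<open>I\<close>, \<open>J\<close> form a finite set depending on \<open>c\<close> alone.\<close>

lemma tpoly_root_line:
  assumes c: "hom_tpoly 1 e c" and root: "tpoly_root 1 e c (\<lambda>k. ereal (x k))"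
  shows "\<exists>I\<in>exponents 1 e. \<exists>J\<in>exponents 1 e.
           x 1 - x 0 = (real_of_ereal (c J) - real_of_ereal (c I)) / (real (I 1) - real (J 1))"
proof -
  let ?T = "tterm 1 c (\<lambda>k. ereal (x k))" and ?E = "tpoly_eval 1 e c (\<lambda>k. ereal (x k))"
  obtain I J where I: "I \<in> exponents 1 e" and J: "J \<in> exponents 1 e" and "I \<noteq> J"
    and TI: "?T I = ?E" and TJ: "?T J = ?E"
    using root by (auto simp: tpoly_root_def)
  \<comment> \<open>The term of \<open>K\<close> is finite at a finite point, which excludes a tie
    at -\<infinity>.\<close>
  obtain K where K: "K \<in> exponents 1 e" "c K \<noteq> -\<infinity>"
    using c by (auto simp: hom_tpoly_def)
  have "?T K \<le> ?E"
    unfolding tpoly_eval_def using K by (intro Max_ge) (auto simp: finite_exponents)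
  then have "?E \<noteq> -\<infinity>"
    using K by (auto simp: tterm_real)
  then have "c I \<noteq> -\<infinity>" "c J \<noteq> -\<infinity>"
    using TI TJ by (auto simp: tterm_real)
  then obtain a b where a: "c I = ereal a" and b: "c J = ereal b"
    using c I J by (metis ereal_cases hom_tpoly_def)
  have "a + (real (I 0) * x 0 + real (I 1) * x 1) = b + (real (J 0) * x 0 + real (J 1) * x 1)"
    using trans[OF TI TJ[symmetric]] by (simp add: tterm_real a b)
  moreover have "real (I 0) = real e - real (I 1)" "real (J 0) = real e - real (J 1)"
    using I J unfolding exponents_1_iff by auto
  ultimately have "(real (I 1) - real (J 1)) * (x 1 - x 0) = b - a"
    by (simp add: algebra_simps)
  moreover have "I 1 \<noteq> J 1"
    using exponents_1_eqI[OF I J] \<open>I \<noteq> J\<close> by blast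
  ultimately have "x 1 - x 0 = (b - a) / (real (I 1) - real (J 1))"
    by (simp add: field_simps)
  then show ?thesis
    using I J a b by (intro bexI[of _ I] bexI[of _ J]) auto
qed

lemma tterm_cong: "(\<And>k. k \<le> n \<Longrightarrow> x k = y k) \<Longrightarrow> tterm n c x I = tterm n c y I"
  by (simp add: tterm_def)

text \<open>Representatives of projective points are \<open>undefined\<close> beyond index
  \<open>n\<close>; this replaces them by real tuples given by a formula for all indices.\<close>

lemma tpoly_root_cong:
  assumes "\<And>k. k \<le> n \<Longrightarrow> x k = y k"
  shows "tpoly_root n e c x \<longleftrightarrow> tpoly_root n e c y"
proof -
  have "tterm n c x = tterm n c y"
    using assms by (intro ext tterm_cong) auto
  then show ?thesis
    by (simp add: tpoly_root_def tpoly_eval_def)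
qed

lemma trop_alg_nondegenerate_line: "trop_alg_nondegenerate 1 line"
  unfolding trop_alg_nondegenerate_def
proof (intro allI impI notI)
  fix e :: nat and c :: "(nat \<Rightarrow> nat) \<Rightarrow> ereal"
  assume c: "hom_tpoly 1 e c"
    and sub: "range (curve_point 1 line) \<subseteq> trop_hypersurface 1 e c"
  \<comment> \<open>All candidates for \<open>x 1 - x 0\<close> at a root. Pairs with
    \<open>I 1 = J 1\<close> only add the harmless value \<open>0\<close>.\<close>
  define S where "S = (\<lambda>(I, J). (real_of_ereal (c J) - real_of_ereal (c I)) /
      (real (I 1) - real (J 1))) ` (exponents 1 e \<times> exponents 1 e)"
  have "t \<in> S" for t
  proof -
    obtain x where x: "x \<in> curve_point 1 line t" and root: "tpoly_root 1 e c x"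
      using sub by (auto simp: trop_hypersurface_def)
    \<comment> \<open>The shift \<open>a\<close> between representatives cancels in the difference
      of coordinates, which is \<open>t\<close>.\<close>
    then obtain a where "\<forall>k\<le>1. x k = ereal (a + line k t)"
      by (auto simp: curve_point_def tproj_rel_def)
    then have "tpoly_root 1 e c (\<lambda>k. ereal (a + line k t))"
      using root tpoly_root_cong[of 1 x "\<lambda>k. ereal (a + line k t)"] by simp
    from tpoly_root_line[OF c this] show ?thesis
      by (auto simp: S_def line_def)
  qed
  moreover have "finite S"
    by (simp add: S_def finite_exponents)
  ultimately show False
    using infinite_UNIV_char_0[where 'a = real] by (metis finite_subset subsetI)
qed

theorem mainTheorem8:
  fixes d :: nat
  assumes "d > 1"
  shows "\<exists>(n::nat) (q::nat) (M::nat) (f :: nat \<Rightarrow> real \<Rightarrow> real)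
            (dg :: nat \<Rightarrow> nat) (P :: nat \<Rightarrow> (nat \<Rightarrow> nat) \<Rightarrow> ereal) (lam::nat).
           n > 0 \<and> q > 0 \<and> M = ((n + d) choose d) - 1 \<and> q > M \<and>
           tropical_holomorphic_curve n f \<and>
           trop_alg_nondegenerate n f \<and>
           Limsup at_top (\<lambda>r. ereal (ln (trop_T n f r) / r)) = 0 \<and>
           (\<forall>j\<le>q. hom_tpoly n (dg j) (P j)) \<and>
           Lcm (dg ` {..q}) = d \<and>
           lam = ddg n d {M+1..q} dg P f \<and>
           \<not> (\<Sum>j\<le>q. trop_defect n (dg j) (P j) f) \<le> ereal ((real n + 1 + real lam) / real d)"
proof -
  \<comment> \<open>The coefficient \<open>j\<close> only serves to make the polynomials \<open>P 0, \<dots>, P (d + 1)\<close> pairwise distinct.\<close>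
  define I where "I j = (\<lambda>k::nat. if k = 0 then d - j else if k = 1 then j else 0)" for j :: nat
  \<comment> \<open>There are \<open>d + 2\<close> indices but only \<open>d + 1\<close> exponents
    of degree \<open>d\<close>; \<open>min\<close> lets the last index reuse the exponent of
    \<open>j = d\<close>.\<close>
  define P where "P j = tmonomial (I (min j d)) (real j)" for j
  define lam where "lam = ddg 1 d {d+1..d+1} (\<lambda>_. d) P line"
  have I: "I (min j d) \<in> exponents 1 d" for j
    unfolding exponents_1_iff by (auto simp: I_def)
  have defect: "trop_defect 1 d (P j) line = 1" for j
    unfolding P_def
    by (rule trop_defect_eq_1_if_affine[where m = "real (I (min j d) 1)" and k = "real j"])
      (use tpoly_comp_tmonomial[OF I] in \<open>simp add: line_def\<close>)
  \<comment> \<open>The index range is a singleton, so completeness need not be decided.\<close>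
  have "lam \<le> card {d+1..d+1}"
    unfolding lam_def ddg_def by (rule card_mono) auto
  \<comment> \<open>The numerator is at most \<open>3\<close> and \<open>d\<close> is at least
    \<open>2\<close>.\<close>
  then have "(real 1 + 1 + real lam) / real d \<le> 3 / 2"
    using assms by (intro frac_le) auto
  also have "\<dots> < real (d + 2)"
    by simp
  finally have "\<not> (\<Sum>j\<le>d+1. trop_defect 1 d (P j) line) \<le> ereal ((real 1 + 1 + real lam) / real d)"
    unfolding defect sum_constant by (simp add: one_ereal_def not_le)
  moreover have "\<forall>j\<le>d+1. hom_tpoly 1 d (P j)"
    unfolding P_def by (intro allI impI hom_tpoly_tmonomial I)
  moreover have "Lcm ((\<lambda>_. d) ` {..d+1}) = d"
    by (simp only: image_constant_conv) simp
  moreover have "d = ((1 + d) choose d) - 1"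
    by simp
  moreover have "lam = ddg 1 d {d+1..d+1} (\<lambda>_. d) P line"
    by (fact lam_def)
  moreover have "(1::nat) > 0" "d + 1 > 0" "d + 1 > d"
    by simp_all
  moreover note tropical_holomorphic_curve_line[of 1] trop_alg_nondegenerate_line
    Limsup_ln_trop_T_line
  ultimately show ?thesis
    by - (rule exI[of _ 1], rule exI[of _ "d + 1"],
      rule exI[of _ d], rule exI[of _ line], rule exI[of _ "\<lambda>_. d"], rule exI[of _ P],
      rule exI[of _ lam], (intro conjI; assumption))
qed

end
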